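(* Let $r,t,k,f\in\mathbb{N}$. Let $P^{(1)},\dots,P^{(f)}\in\mathbb{Z}[x]$ be non-constant polynomials with $P^{(1)}(0)=\cdots=P^{(f)}(0)=0$ and with positive leading coefficients. There exists a partition $\mathbb{N}^k=\bigcup_{i=1}^r E_i$ such that for every finite coloring of $\mathbb{N}^k$ with $t$ colors, $\mathbb{N}^k=\bigcup_{j=1}^t F_j$, there exist a single color class $F_m$, $1\le m\le t$, an element $x_0\in\mathbb{N}$, and a set $H\subset\mathbb{N}$ of positive lower density such that for every $h\in H$, every $j\in\{1,\dots,f\}$ and every $i\in\{1,\dots,r\}$, the set \[ \big(F_m+(x_0+P^{(j)}(h))\mathbf{1}_k\big)\cap E_i \] has infinitely many elements.
   Context: $\mathbb{N}$ is the set of positive integers. $\mathbf{1}_k=(1,\dots,1)\in\mathbb{N}^k$. For $F\subseteq\mathbb{N}^k$ and $s\in\mathbb{Z}$, $F+s\mathbf{1}_k=\{\mathbf{a}+s\mathbf{1}_k:\mathbf{a}\in F\}$. A coloring of $\mathbb{N}^k$ with $t$ colors is a partition of $\mathbb{N}^k$ into $t$ pairwise disjoint sets $F_1,\dots,F_t$ (the color classes). The lower density of $A\subseteq\mathbb{N}$ is $\underline{d}(A)=\liminf_{N\to\infty}\frac{|A\cap[1,N]|}{N}$. *)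

theory Defs
  imports "HOL-Analysis.Analysis" "HOL-Computational_Algebra.Polynomial"
begin

text \<open>
  The dimension \<open>k\<close> is \<open>CARD('k)\<close>. The ambient type is \<open>int ^ 'k\<close> rather than \<open>nat ^ 'k\<close>, since
  \<open>\<nat>\<^sup>k\<close> (with positive coordinates) is translated by possibly negative amounts.
\<close>

definition pos_vecs :: "(int ^ 'k) set" where
  "pos_vecs = {a. \<forall>i. 0 < a $ i}"

text \<open>Here \<open>1\<close> is the all-ones vector.\<close>

definition diag_shift :: "(int ^ 'k) set \<Rightarrow> int \<Rightarrow> (int ^ 'k) set" where
  "diag_shift F s = (\<lambda>a. a + s *s 1) ` F"

text \<open>Parts are indexed by \<open>{1..n}\<close> and may be empty.\<close>

definition partition_into :: "nat \<Rightarrow> (nat \<Rightarrow> 'a set) \<Rightarrow> 'a set \<Rightarrow> bool" where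
  "partition_into n E A \<longleftrightarrow> (\<Union>i\<in>{1..n}. E i) = A \<and> disjoint_family_on E {1..n}"

definition lower_density :: "nat set \<Rightarrow> ereal" where
  "lower_density A = liminf (\<lambda>N. ereal (real (card (A \<inter> {1..N})) / real N))"

end

theory Submission
  imports Defs "HOL-Library.Discrete_Functions"
begin

text \<open>
  Take a sequence in which every finite word over the \<open>r\<close> letters occurs infinitely often, and
  let \<open>E i\<close> consist of the vectors whose value at a fixed coordinate carries the letter \<open>i\<close>. Call a
  shift bad for a colour class \<open>F m\<close> if the shifted class meets some \<open>E i\<close> in a finite set only. If
  every class had infinitely many bad shifts, one could choose pairwise distinct bad shifts \<open>s m\<close>,
  with missed letters \<open>e m\<close>. But infinitely many \<open>n\<close> carry the letter \<open>e m\<close> at \<open>n + s m\<close> for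
  all \<open>m\<close> simultaneously, and infinitely many of these \<open>n\<close>, as points of the diagonal, lie in the
  same class, a contradiction. So some class has only finitely many bad shifts, and non-constant
  polynomials avoid these for all but finitely many \<open>h\<close>.
\<close>

lemma exists_universal_sequence:
  "\<exists>c :: nat \<Rightarrow> 'a::countable. \<forall>L g. infinite {n. \<forall>s<L. c (n + s) = g s}"
proof -
  define c :: "nat \<Rightarrow> 'a" where
    "c = (\<lambda>n. snd (from_nat (floor_log n) :: nat \<times> 'a list) ! (n - 2 ^ floor_log n))"
  have "infinite {n. \<forall>s<L. c (n + s) = g s}" for L g
  proof -
    define w where "w = map g [0..<L]"
    \<comment> \<open>Since \<open>L \<le> q < 2 ^ q\<close>, the whole word fits into the block
      starting at \<open>2 ^ q\<close>.\<close>
    define Q where "Q = range (\<lambda>p::nat. to_nat (p, w)) \<inter> {L..}"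
    have "infinite (range (\<lambda>p::nat. to_nat (p, w)))"
      by (intro range_inj_infinite injI) auto
    moreover have "range (\<lambda>p::nat. to_nat (p, w)) \<subseteq> Q \<union> {..<L}"
      by (auto simp: Q_def)
    ultimately have "infinite Q"
      using finite_subset by blast
    moreover have "inj_on (\<lambda>q. 2 ^ q :: nat) Q"
      by (auto simp: inj_on_def)
    ultimately have "infinite ((\<lambda>q. 2 ^ q :: nat) ` Q)"
      by (simp add: finite_image_iff)
    moreover have "(\<lambda>q. 2 ^ q) ` Q \<subseteq> {n. \<forall>s<L. c (n + s) = g s}"
    proof safe
      fix q s assume q: "q \<in> Q" and s: "s < L"
      have "s < 2 ^ q"
        using q s less_exp[of q] by (auto simp: Q_def intro: order.strict_trans2)
      then have "floor_log (2 ^ q + s) = q"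
        by (intro floor_log_eqI) auto
      then show "c (2 ^ q + s) = g s"
        using q s by (auto simp: c_def Q_def w_def)
    qed
    ultimately show ?thesis
      using finite_subset by blast
  qed
  then show ?thesis by blast
qed

lemma universal_sequence_int_pattern:
  fixes c :: "nat \<Rightarrow> 'a" and s :: "'i \<Rightarrow> int"
  \<comment> \<open>Distinct offsets make no conflicting demands, so the letters \<open>e i\<close>
    at offsets \<open>s i\<close> are part of one finite word. Moving the start by \<open>A\<close>
    makes the possibly negative offsets natural numbers below \<open>2 * A\<close>.\<close>
  assumes c: "\<And>L g. infinite {n. \<forall>s<L. c (n + s) = g s}"
    and "finite I" and inj: "inj_on s I"
  shows "infinite {n::nat. \<forall>i\<in>I. 0 < int n + s i \<and> c (nat (int n + s i)) = e i}"
proof -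
  obtain A :: nat where A: "\<And>i. i \<in> I \<Longrightarrow> \<bar>s i\<bar> < int A"
  proof
    fix i assume "i \<in> I"
    then have "nat \<bar>s i\<bar> \<le> (\<Sum>i\<in>I. nat \<bar>s i\<bar>)"
      using \<open>finite I\<close> by (intro member_le_sum) auto
    then show "\<bar>s i\<bar> < int (Suc (\<Sum>i\<in>I. nat \<bar>s i\<bar>))" by linarith
  qed
  define g where "g = (\<lambda>u. e (the_inv_into I s (int u - int A)))"
  have "infinite ((\<lambda>n. n + A) ` {n. \<forall>u<2 * A. c (n + u) = g u})"
    using c[of "2 * A" g] by (simp add: finite_image_iff)
  moreover have "(\<lambda>n. n + A) ` {n. \<forall>u<2 * A. c (n + u) = g u}
      \<subseteq> {n::nat. \<forall>i\<in>I. 0 < int n + s i \<and> c (nat (int n + s i)) = e i}"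
  proof (clarsimp, intro conjI)
    fix n i assume n: "\<forall>u<2 * A. c (n + u) = g u" and i: "i \<in> I"
    show "0 < int n + int A + s i" using A[OF i] by linarith
    define u where "u = nat (int A + s i)"
    have u: "u < 2 * A" "int u = int A + s i"
      using A[OF i] by (auto simp: u_def)
    have "nat (int n + int A + s i) = n + u" using u by linarith
    moreover have "g u = e i"
      using u inj i by (simp add: g_def the_inv_into_f_f)
    ultimately show "c (nat (int n + int A + s i)) = e i"
      using n u by auto
  qed
  ultimately show ?thesis
    using finite_subset by blast
qed

lemma distinct_representatives_infinite:
  assumes "finite I" "\<And>i. i \<in> I \<Longrightarrow> infinite (B i)"
  shows "\<exists>s. inj_on s I \<and> (\<forall>i\<in>I. s i \<in> B i)"
  using assms
proof (induction I rule: finite_induct)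
  case empty
  then show ?case by simp
next
  case (insert x I)
  then obtain s where s: "inj_on s I" "\<forall>i\<in>I. s i \<in> B i" by auto
  obtain b where "b \<in> B x" "b \<notin> s ` I"
    using insert by (meson finite_imageI finite_subset insertI1 subsetI)
  then have "inj_on (s(x := b)) (insert x I)" "\<forall>i\<in>insert x I. (s(x := b)) i \<in> B i"
    using s insert.hyps by (auto simp: inj_on_def)
  then show ?case by blast
qed

lemma lower_density_cofinite_pos:
  assumes "finite (- H)"
  shows "lower_density H > 0"
proof -
  define K where "K = card (- H)"
  \<comment> \<open>At most \<open>K\<close> of the numbers up to \<open>N\<close> are missing from
    \<open>H\<close>, which is less than half of them once \<open>N > 2 * K\<close>.\<close>
  have "ereal (1/2) \<le> ereal (real (card (H \<inter> {1..N})) / real N)" if "N \<ge> 2 * K + 1" for N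
  proof -
    have "N = card ((H \<inter> {1..N}) \<union> (- H \<inter> {1..N}))"
      by (metis Int_Un_distrib2 Compl_partition Int_UNIV_left card_atLeastAtMost diff_Suc_1
          add.commute plus_1_eq_Suc)
    also have "\<dots> \<le> card (H \<inter> {1..N}) + card (- H \<inter> {1..N})"
      by (rule card_Un_le)
    also have "card (- H \<inter> {1..N}) \<le> K"
      unfolding K_def using assms by (intro card_mono) auto
    finally show ?thesis using that by (simp add: field_simps)
  qed
  then have "ereal (1/2) \<le> lower_density H"
    unfolding lower_density_def
    by (intro Liminf_bounded eventually_sequentiallyI)
  then show ?thesis
    by (rule less_le_trans[rotated]) simp
qed

lemma finite_nat_poly_preimage:
  fixes p :: "int poly"
  assumes "degree p > 0" "finite B"
  shows "finite {h::nat. poly p (int h) \<in> B}"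
proof -
  have "finite {x. poly p x = b}" for b
  proof -
    have "p \<noteq> [:b:]" using assms(1) by auto
    then have "finite {x. poly (p - [:b:]) x = 0}"
      by (intro poly_roots_finite) simp
    then show ?thesis by simp
  qed
  then have "finite (\<Union>b\<in>B. {x. poly p x = b})" using assms(2) by blast
  moreover have "int ` {h. poly p (int h) \<in> B} \<subseteq> (\<Union>b\<in>B. {x. poly p x = b})" by auto
  ultimately show ?thesis
    by (meson finite_imageD finite_subset inj_on_of_nat)
qed

text \<open>The sequence ranges over all naturals; reduction modulo \<open>r\<close> leaves
  \<open>r\<close> letters, and adding 1 matches the index set \<open>{1..r}\<close>.\<close>

definition letter_part :: "(nat \<Rightarrow> nat) \<Rightarrow> nat \<Rightarrow> 'k \<Rightarrow> nat \<Rightarrow> (int ^ 'k) set" where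
  "letter_part c r \<kappa> i = {a \<in> pos_vecs. c (nat (a $ \<kappa>)) mod r + 1 = i}"

lemma partition_into_letter_part:
  assumes "r \<ge> 1"
  shows "partition_into r (letter_part c r \<kappa>) pos_vecs"
proof -
  have "Suc (x mod r) \<le> r" for x
    using assms by (simp add: Suc_leI)
  then show ?thesis
    by (auto simp: partition_into_def letter_part_def disjoint_family_on_def)
qed

definition bad_shifts :: "nat \<Rightarrow> (nat \<Rightarrow> (int ^ 'k) set) \<Rightarrow> (int ^ 'k) set \<Rightarrow> int set" where
  "bad_shifts r E G = {s. \<exists>i\<in>{1..r}. finite (diag_shift G s \<inter> E i)}"

lemma exists_class_finite_bad_shifts:
  fixes F :: "nat \<Rightarrow> (int ^ 'k) set"
  assumes c: "\<And>L g. infinite {n. \<forall>s<L. c (n + s) = g s}"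
    and F: "partition_into t F pos_vecs"
  shows "\<exists>m\<in>{1..t}. finite (bad_shifts r (letter_part c r \<kappa>) (F m))"
proof (rule ccontr)
  assume "\<not> ?thesis"
  \<comment> \<open>Injectivity is essential: two classes with the same shift could require
    different letters at the same position.\<close>
  then obtain s where s: "inj_on s {1..t}"
      "\<And>m. m \<in> {1..t} \<Longrightarrow> s m \<in> bad_shifts r (letter_part c r \<kappa>) (F m)"
    using distinct_representatives_infinite[of "{1..t}"
        "\<lambda>m. bad_shifts r (letter_part c r \<kappa>) (F m)"] by auto
  have "\<exists>e. \<forall>m\<in>{1..t}. e m \<in> {1..r} \<and> finite (diag_shift (F m) (s m) \<inter> letter_part c r \<kappa> (e m))"
    using s(2) unfolding bad_shifts_def by (intro bchoice) blast
  then obtain e where e: "\<And>m. m \<in> {1..t} \<Longrightarrow> e m \<in> {1..r}"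
      "\<And>m. m \<in> {1..t} \<Longrightarrow> finite (diag_shift (F m) (s m) \<inter> letter_part c r \<kappa> (e m))"
    by blast
  \<comment> \<open>As \<open>e m - 1 < r\<close>, the value \<open>e m - 1\<close> is its own
    residue and stands for the letter \<open>e m\<close>. Dropping 0 puts the diagonal points
    \<open>vec (int n)\<close> into \<open>pos_vecs\<close>.\<close>
  define V where "V = {n::nat. \<forall>m\<in>{1..t}. 0 < int n + s m \<and> c (nat (int n + s m)) = e m - 1} \<inter> {1..}"
  have "infinite {n::nat. \<forall>m\<in>{1..t}. 0 < int n + s m \<and> c (nat (int n + s m)) = e m - 1}"
    using c s(1) by (intro universal_sequence_int_pattern) auto
  moreover have "{n::nat. \<forall>m\<in>{1..t}. 0 < int n + s m \<and> c (nat (int n + s m)) = e m - 1} \<subseteq> insert 0 V"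
    by (auto simp: V_def)
  ultimately have "infinite V"
    using finite_subset by blast
  moreover have "V \<subseteq> (\<Union>m\<in>{1..t}. {n \<in> V. vec (int n) \<in> F m})"
  proof
    fix n assume "n \<in> V"
    then have "(vec (int n) :: int ^ 'k) \<in> pos_vecs"
      by (auto simp: V_def pos_vecs_def)
    then show "n \<in> (\<Union>m\<in>{1..t}. {n \<in> V. vec (int n) \<in> F m})"
      using F \<open>n \<in> V\<close> unfolding partition_into_def by blast
  qed
  \<comment> \<open>Pigeonhole: finitely many classes cover the infinite set
    \<open>V\<close>.\<close>
  ultimately obtain m where m: "m \<in> {1..t}" "infinite {n \<in> V. vec (int n) \<in> F m}"
    using finite_subset by blast
  have "inj_on (\<lambda>n. vec (int n + s m) :: int ^ 'k) {n \<in> V. vec (int n) \<in> F m}"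
    by (auto simp: inj_on_def vec_eq_iff)
  then have "infinite ((\<lambda>n. vec (int n + s m) :: int ^ 'k) ` {n \<in> V. vec (int n) \<in> F m})"
    using m(2) by (simp add: finite_image_iff)
  moreover have "(\<lambda>n. vec (int n + s m)) ` {n \<in> V. vec (int n) \<in> F m}
      \<subseteq> diag_shift (F m) (s m) \<inter> letter_part c r \<kappa> (e m)"
  proof clarify
    fix n assume n: "n \<in> V" "vec (int n) \<in> F m"
    have "vec (int n + s m) = (vec (int n) :: int ^ 'k) + s m *s 1"
      by (simp add: vec_eq_iff)
    then have "vec (int n + s m) \<in> diag_shift (F m) (s m)"
      using n(2) by (simp add: diag_shift_def)
    moreover have "vec (int n + s m) \<in> letter_part c r \<kappa> (e m)"
      using n(1) m(1) e(1)[OF m(1)] by (auto simp: V_def letter_part_def pos_vecs_def)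
    ultimately show "vec (int n + s m) \<in> diag_shift (F m) (s m) \<inter> letter_part c r \<kappa> (e m)"
      by blast
  qed
  ultimately show False
    using e(2)[OF m(1)] finite_subset by blast
qed

theorem theorem1p3:
  fixes r t f :: nat and P :: "nat \<Rightarrow> int poly"
  assumes "r \<ge> 1" and "t \<ge> 1" and "f \<ge> 1"
    and "\<And>j. j \<in> {1..f} \<Longrightarrow> degree (P j) > 0"
    and "\<And>j. j \<in> {1..f} \<Longrightarrow> poly (P j) 0 = 0"
    and "\<And>j. j \<in> {1..f} \<Longrightarrow> lead_coeff (P j) > 0"
  shows "\<exists>E :: nat \<Rightarrow> (int ^ 'k) set. partition_into r E pos_vecs \<and>
    (\<forall>F. partition_into t F (pos_vecs :: (int ^ 'k) set) \<longrightarrow>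
      (\<exists>m\<in>{1..t}. \<exists>x0::nat. x0 \<ge> 1 \<and>
        (\<exists>H. H \<subseteq> {1..} \<and> lower_density H > 0 \<and>
          (\<forall>h\<in>H. \<forall>j\<in>{1..f}. \<forall>i\<in>{1..r}.
            infinite (diag_shift (F m) (int x0 + poly (P j) (int h)) \<inter> E i)))))"
proof -
  obtain c :: "nat \<Rightarrow> nat" where c: "\<And>L g. infinite {n. \<forall>s<L. c (n + s) = g s}"
    using exists_universal_sequence by blast
  \<comment> \<open>Any coordinate serves, so \<open>undefined\<close> is a legitimate
    choice.\<close>
  define E :: "nat \<Rightarrow> (int ^ 'k) set" where "E = letter_part c r undefined"
  have "\<exists>m\<in>{1..t}. \<exists>x0::nat. x0 \<ge> 1 \<and> (\<exists>H. H \<subseteq> {1..} \<and> lower_density H > 0 \<and>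
      (\<forall>h\<in>H. \<forall>j\<in>{1..f}. \<forall>i\<in>{1..r}.
        infinite (diag_shift (F m) (int x0 + poly (P j) (int h)) \<inter> E i)))"
    if F: "partition_into t F pos_vecs" for F :: "nat \<Rightarrow> (int ^ 'k) set"
  proof -
    obtain m where m: "m \<in> {1..t}" "finite (bad_shifts r E (F m))"
      using exists_class_finite_bad_shifts[OF c F] unfolding E_def by blast
    \<comment> \<open>The choice is \<open>x0 = 1\<close>. The complement of \<open>H\<close> then
      consists of 0 and the preimages under the \<open>P j\<close> of the finitely many bad shifts
      lowered by 1, so \<open>H\<close> is cofinite.\<close>
    define H where
      "H = {h::nat. h \<ge> 1 \<and> (\<forall>j\<in>{1..f}. int 1 + poly (P j) (int h) \<notin> bad_shifts r E (F m))}"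
    have "- H \<subseteq> insert 0 (\<Union>j\<in>{1..f}. {h. poly (P j) (int h) \<in> (\<lambda>b. b - 1) ` bad_shifts r E (F m)})"
      by (force simp: H_def image_iff not_le)
    moreover have "finite \<dots>"
      using assms(4) m(2) by (intro finite.insertI finite_UN_I finite_nat_poly_preimage) auto
    ultimately have "lower_density H > 0"
      by (intro lower_density_cofinite_pos) (rule finite_subset)
    moreover have "H \<subseteq> {1..}" by (auto simp: H_def)
    moreover have "infinite (diag_shift (F m) (int 1 + poly (P j) (int h)) \<inter> E i)"
      if "h \<in> H" "j \<in> {1..f}" "i \<in> {1..r}" for h j i
      using that unfolding H_def bad_shifts_def by blast
    ultimately show ?thesis using m(1) by blast
  qed
  moreover have "partition_into r E pos_vecs"
    unfolding E_def using assms(1) by (rule partition_into_letter_part)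
  ultimately show ?thesis by blast
qed

end
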